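(* Let $S=\langle g_1,\dots,g_n\rangle$ be an $M$-pure numerical semigroup, let $R=K[[t^S]]$ be its numerical semigroup ring with maximal ideal $\mathbf m$, and let $J=(t^{g_1})\subset R$. If $G(\mathbf m)$ is Buchsbaum, then $s_J(\mathbf m)=r$.
   Context: $K$ is an infinite field. A numerical semigroup $S\subseteq\mathbb N$ (with $0\in S$) has minimal generators $g_1<\dots<g_n$ with $\gcd(g_1,\dots,g_n)=1$. $R=K[[t^S]]=K[[t^{g_1},\dots,t^{g_n}]]$, $\mathbf m=(t^{g_1},\dots,t^{g_n})$, $G(\mathbf m)=\bigoplus_{i\ge0}\mathbf m^i/\mathbf m^{i+1}$, and $\mathcal M$ is the homogeneous maximal ideal of $G(\mathbf m)$. $r$ is the reduction number of $\mathbf m$, i.e. the least $r\ge0$ with $\mathbf m^{r+1}=t^{g_1}\mathbf m^r$. For $J=(t^{g_1})$, the index of nilpotency of $\mathbf m$ with respect to $J$ is $s_J(\mathbf m)=\min\{n\ge 0:\mathbf m^{n+1}\subseteq J\}$. $G(\mathbf m)$ is called Buchsbaum if $\mathcal M\cdot H^0_{\mathcal M}=0$, where $H^0_{\mathcal M}=\bigcup_{k\ge1}(0:_{G(\mathbf m)}\mathcal M^k)$. Apery set: $\mathrm{Ap}_{g_1}(S)=\{\omega_0,\dots,\omega_{g_1-1}\}$, where $\omega_i=\min\{s\in S: s\equiv i \bmod g_1\}$. Let $M=S\setminus\{0\}$, $hM=M+\dots+M$ ($h$ summands), $0M=S$. For $s\in S$, $\mathrm{ord}(s)=h$ if $s\in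 hM\setminus(h+1)M$. Partial order on $S$: $u\le_M u'$ if there is $s\in S$ with $u+s=u'$ and $\mathrm{ord}(u)+\mathrm{ord}(s)=\mathrm{ord}(u')$. $\mathrm{maxAp}_M(S)$ is the set of maximal elements of $\mathrm{Ap}_{g_1}(S)$ with respect to $\le_M$. $S$ is $M$-pure if all elements of $\mathrm{maxAp}_M(S)$ have the same order $\mathrm{ord}$. *)

theory Defs
  imports
    "HOL-Algebra.QuotRing"
    "HOL-Algebra.Ideal_Product"
    "HOL-Computational_Algebra.Formal_Power_Series"
begin

section \<open>Numerical semigroups\<close>

definition semigroup_span :: "nat set \<Rightarrow> nat set" where
  "semigroup_span A = {\<Sum>a\<in>A. c a * a | c :: nat \<Rightarrow> nat. True}"

text \<open>\<open>S\<close> is the numerical semigroup minimally generated by \<open>g 1 < \<dots> < g n\<close>. Minimality makes every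
  \<open>g i\<close> positive, since \<open>0\<close> lies in every span, and the gcd condition forces \<open>n \<ge> 1\<close>.\<close>
definition numerical_semigroup_gens :: "nat set \<Rightarrow> (nat \<Rightarrow> nat) \<Rightarrow> nat \<Rightarrow> bool" where
  "numerical_semigroup_gens S g n \<longleftrightarrow>
     strict_mono_on {1..n} g \<and>
     Gcd (g ` {1..n}) = 1 \<and>
     S = semigroup_span (g ` {1..n}) \<and>
     (\<forall>i\<in>{1..n}. g i \<notin> semigroup_span (g ` {1..n} - {g i}))"

definition multM :: "nat set \<Rightarrow> nat \<Rightarrow> nat set" where
  "multM S h = (if h = 0 then S else {sum_list xs | xs. length xs = h \<and> set xs \<subseteq> S - {0}})"

text \<open>For \<open>s \<in> S\<close> exactly one such \<open>h\<close> exists, as the sets \<open>multM S h\<close> decrease and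
  \<open>s \<notin> multM S (s + 1)\<close>; outside \<open>S\<close> the value is irrelevant.\<close>
definition sg_ord :: "nat set \<Rightarrow> nat \<Rightarrow> nat" where
  "sg_ord S s = (THE h. s \<in> multM S h \<and> s \<notin> multM S (Suc h))"

definition Apery :: "nat set \<Rightarrow> nat \<Rightarrow> nat set" where
  "Apery S e = (\<lambda>i. LEAST s. s \<in> S \<and> s mod e = i mod e) ` {..<e}"

definition leM :: "nat set \<Rightarrow> nat \<Rightarrow> nat \<Rightarrow> bool" where
  "leM S u u' \<longleftrightarrow> (\<exists>s\<in>S. u + s = u' \<and> sg_ord S u + sg_ord S s = sg_ord S u')"

definition maxAp :: "nat set \<Rightarrow> nat \<Rightarrow> nat set" where
  "maxAp S e = {w \<in> Apery S e. \<forall>u\<in>Apery S e. leM S w u \<longrightarrow> u = w}"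

definition M_pure :: "nat set \<Rightarrow> nat \<Rightarrow> bool" where
  "M_pure S e \<longleftrightarrow> (\<forall>u\<in>maxAp S e. \<forall>v\<in>maxAp S e. sg_ord S u = sg_ord S v)"


section \<open>The ring \<open>K[[t^S]]\<close>\<close>

text \<open>The subring of \<open>K[[t]]\<close> of power series supported in \<open>S\<close>; the variable \<open>t\<close> is \<^const>\<open>fps_X\<close>.\<close>
definition semigroup_ring :: "nat set \<Rightarrow> 'k::field fps ring" where
  "semigroup_ring S =
     \<lparr>carrier = {f. \<forall>i. fps_nth f i \<noteq> 0 \<longrightarrow> i \<in> S}, monoid.mult = (*), one = 1, ring.zero = 0, add = (+)\<rparr>"

definition semigroup_max_ideal :: "nat set \<Rightarrow> (nat \<Rightarrow> nat) \<Rightarrow> nat \<Rightarrow> 'k::field fps set" where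
  "semigroup_max_ideal S g n = Idl\<^bsub>semigroup_ring S\<^esub> ((\<lambda>i. fps_X ^ g i) ` {1..n})"


section \<open>Ideals: powers, reduction number, index of nilpotency\<close>

abbreviation ideal_pow :: "('a, 'b) ring_scheme \<Rightarrow> 'a set \<Rightarrow> nat \<Rightarrow> 'a set" where
  "ideal_pow R I k \<equiv> I [^]\<^bsub>ideals_set R\<^esub> k"

text \<open>The reduction number of \<open>I\<close> with respect to the principal ideal generated by \<open>x\<close>.\<close>
definition reduction_number :: "('a, 'b) ring_scheme \<Rightarrow> 'a set \<Rightarrow> 'a \<Rightarrow> nat" where
  "reduction_number R I x = (LEAST r. ideal_pow R I (r + 1) = x <#\<^bsub>R\<^esub> ideal_pow R I r)"

definition nilpotency_index :: "('a, 'b) ring_scheme \<Rightarrow> 'a set \<Rightarrow> 'a set \<Rightarrow> nat" where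
  "nilpotency_index R J I = (LEAST k. ideal_pow R I (k + 1) \<subseteq> J)"


section \<open>The associated graded ring\<close>

text \<open>An element of \<open>\<Oplus>i. I^i/I^(i+1)\<close> is the family of its components, the degree \<open>i\<close> component
  being a coset of \<open>I^(i+1)\<close> contained in \<open>I^i\<close>. The product of a class in degree \<open>i\<close> and a class
  in degree \<open>k - i\<close> is the class modulo \<open>I^(k+1)\<close> of the product of any representatives; these
  are summed in the additive group of \<open>R/I^(k+1)\<close>, which contains \<open>I^k/I^(k+1)\<close>.\<close>
definition assoc_graded :: "('a, 'b) ring_scheme \<Rightarrow> 'a set \<Rightarrow> (nat \<Rightarrow> 'a set) ring" where
  "assoc_graded R I =
     \<lparr>carrier = {f. (\<forall>i. f i \<in> (\<lambda>x. ideal_pow R I (Suc i) +>\<^bsub>R\<^esub> x) ` ideal_pow R I i) \<and>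
                     finite {i. f i \<noteq> ideal_pow R I (Suc i)}},
      monoid.mult = (\<lambda>f h k. finsum (R Quot (ideal_pow R I (Suc k)))
                 (\<lambda>i. rcoset_mult R (ideal_pow R I (Suc k)) (f i) (h (k - i))) {..k}),
      one = (\<lambda>i. if i = 0 then ideal_pow R I 1 +>\<^bsub>R\<^esub> \<one>\<^bsub>R\<^esub> else ideal_pow R I (Suc i)),
      ring.zero = (\<lambda>i. ideal_pow R I (Suc i)),
      add = (\<lambda>f h i. f i <+>\<^bsub>R\<^esub> h i)\<rparr>"

text \<open>The ideal of elements with vanishing degree \<open>0\<close> component; it is the homogeneous maximal
  ideal when \<open>I\<close> is a maximal ideal of \<open>R\<close>.\<close>
definition homogeneous_max_ideal :: "('a, 'b) ring_scheme \<Rightarrow> 'a set \<Rightarrow> (nat \<Rightarrow> 'a set) set" where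
  "homogeneous_max_ideal R I =
     {f \<in> carrier (assoc_graded R I). f 0 = \<zero>\<^bsub>assoc_graded R I\<^esub> 0}"

definition ideal_annihilator :: "('a, 'b) ring_scheme \<Rightarrow> 'a set \<Rightarrow> 'a set" where
  "ideal_annihilator A I = {x \<in> carrier A. \<forall>y\<in>I. x \<otimes>\<^bsub>A\<^esub> y = \<zero>\<^bsub>A\<^esub>}"

definition local_cohomology0 :: "('a, 'b) ring_scheme \<Rightarrow> 'a set \<Rightarrow> 'a set" where
  "local_cohomology0 A I = (\<Union>k\<in>{1..}. ideal_annihilator A (ideal_pow A I k))"

definition graded_Buchsbaum :: "('a, 'b) ring_scheme \<Rightarrow> 'a set \<Rightarrow> bool" where
  "graded_Buchsbaum R I \<longleftrightarrow>
     (let G = assoc_graded R I; M = homogeneous_max_ideal R I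
      in ideal_prod G M (local_cohomology0 G M) = {\<zero>\<^bsub>G\<^esub>})"

end

theory Submission
  imports Defs
begin

text \<open>
  The power \<open>m\<^sup>h\<close> consists of the power series supported in \<open>hM\<close>, so \<open>s\<^sub>J\<close> is the least \<open>d\<close> with
  \<open>(d+1)M \<subseteq> e + S\<close> and \<open>r\<close> the least \<open>r\<close> with \<open>(r+1)M = e + rM\<close>, where \<open>e = g\<^sub>1\<close>. Clearly
  \<open>s\<^sub>J \<le> r\<close>. By purity and the choice of \<open>d = s\<^sub>J\<close>, every maximal Apery element has order at least \<open>d\<close>.
  If \<open>s \<in> (d+1)M\<close> but \<open>s - e \<notin> dM\<close>, write \<open>s = w + ke\<close> with \<open>w\<close> in the Apery set and \<open>k \<ge> 1\<close>. Then
  \<open>ord w + k - 1 < d\<close>, so \<open>ord (w + ke) > ord w + k\<close>, i.e. the initial form of \<open>t\<^sup>w\<close> is killed by the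
  \<open>k\<close>-th power of that of \<open>t\<^sup>e\<close>, hence by a power of the homogeneous maximal ideal. By the
  Buchsbaum property it is killed by the maximal ideal itself, which makes \<open>w\<close> maximal for \<open>\<le>\<^sub>M\<close>,
  so \<open>ord w \<ge> d\<close>, a contradiction.
\<close>

section \<open>Orders in a numerical semigroup\<close>

text \<open>Here \<open>e\<close> stands for \<open>g 1\<close>, the least nonzero element of
  \<open>S\<close>; \<open>e_le\<close> is what lets multiples of \<open>e\<close> compete with
  arbitrary sums in number of summands.\<close>

locale pointed_semigroup =
  fixes S :: "nat set" and e :: nat
  assumes zero_mem: "0 \<in> S"
    and add_mem: "\<And>a b. a \<in> S \<Longrightarrow> b \<in> S \<Longrightarrow> a + b \<in> S"
    and e_mem: "e \<in> S" and e_pos: "e > 0"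
    and e_le: "\<And>s. s \<in> S \<Longrightarrow> s \<noteq> 0 \<Longrightarrow> e \<le> s"
begin

section \<open>Sums of \<open>h\<close> nonzero elements and the order function\<close>

lemma multM_0 [simp]: "multM S 0 = S"
  by (simp add: multM_def)

lemma multM_1: "multM S (Suc 0) = S - {0}"
proof -
  have "\<exists>xs. x = sum_list xs \<and> length xs = Suc 0 \<and> set xs \<subseteq> S - {0}" if "x \<in> S" "x \<noteq> 0" for x
    using that by (intro exI[of _ "[x]"]) auto
  then show ?thesis by (auto simp: multM_def length_Suc_conv)
qed

lemma sum_list_mem: "set xs \<subseteq> S \<Longrightarrow> sum_list xs \<in> S"
  by (induction xs) (auto intro: zero_mem add_mem)

lemma multM_subset: "multM S h \<subseteq> S"
  using sum_list_mem by (fastforce simp: multM_def split: if_splits)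

lemma sum_list_mem_multM: "set xs \<subseteq> S - {0} \<Longrightarrow> sum_list xs \<in> multM S (length xs)"
proof (cases "xs = []")
  case True
  then show ?thesis by (simp add: zero_mem)
next
  case False
  moreover assume "set xs \<subseteq> S - {0}"
  ultimately show ?thesis unfolding multM_def by simp blast
qed

text \<open>Adding \<open>a\<close> to one of the summands keeps that summand nonzero and the number
  of summands fixed. This makes the series supported in \<open>multM S h\<close> an ideal
  later.\<close>

lemma multM_absorb:
  assumes "a \<in> S" "b \<in> multM S h"
  shows "a + b \<in> multM S h"
proof (cases h)
  case 0
  then show ?thesis using assms add_mem by simp
next
  case (Suc k)
  then obtain xs where xs: "b = sum_list xs" "length xs = Suc k" "set xs \<subseteq> S - {0}"
    using assms(2) by (auto simp: multM_def)
  then obtain y ys where "xs = y # ys" by (cases xs) auto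
  then have "a + b = sum_list ((a + y) # ys)" "length ((a + y) # ys) = h"
    "set ((a + y) # ys) \<subseteq> S - {0}"
    using xs assms(1) Suc add_mem by auto
  then show ?thesis using sum_list_mem_multM by metis
qed

lemma multM_add:
  assumes "a \<in> multM S h" "b \<in> multM S k"
  shows "a + b \<in> multM S (h + k)"
proof (cases "h = 0 \<or> k = 0")
  case True
  then show ?thesis
    using assms multM_absorb[of a b k] multM_absorb[of b a h] by (auto simp: add.commute)
next
  case False
  then obtain xs ys where "a = sum_list xs" "length xs = h" "set xs \<subseteq> S - {0}"
    "b = sum_list ys" "length ys = k" "set ys \<subseteq> S - {0}"
    using assms by (auto simp: multM_def)
  then have "a + b = sum_list (xs @ ys)" "length (xs @ ys) = h + k" "set (xs @ ys) \<subseteq> S - {0}"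
    by auto
  then show ?thesis using sum_list_mem_multM by metis
qed

lemma multM_Suc_split:
  assumes "a \<in> multM S (Suc h)"
  obtains x b where "x \<in> S - {0}" "b \<in> multM S h" "a = x + b"
proof -
  obtain xs where xs: "a = sum_list xs" "length xs = Suc h" "set xs \<subseteq> S - {0}"
    using assms by (auto simp: multM_def)
  then obtain y ys where ys: "xs = y # ys" by (cases xs) auto
  have "sum_list ys \<in> multM S h"
    using xs ys sum_list_mem_multM[of ys] by auto
  then show ?thesis using that[of y "sum_list ys"] xs ys by auto
qed

lemma multM_Suc_subset: "multM S (Suc h) \<subseteq> multM S h"
  by (auto elim!: multM_Suc_split intro: multM_absorb)

lemma multM_antimono: "h \<le> k \<Longrightarrow> multM S k \<subseteq> multM S h"
  by (rule lift_Suc_antimono_le[of "multM S"]) (auto intro: multM_Suc_subset[THEN subsetD])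

lemma multM_ge: "a \<in> multM S h \<Longrightarrow> h \<le> a"
proof (induction h arbitrary: a)
  case (Suc h)
  then show ?case by (auto elim!: multM_Suc_split dest!: Suc.IH)
qed simp

lemma multiple_mem: "j * e \<in> multM S j"
proof (induction j)
  case (Suc j)
  have "e \<in> multM S (Suc 0)" using e_mem e_pos by (simp add: multM_1)
  from multM_add[OF this Suc] show ?case by simp
qed (simp add: zero_mem)

lemma add_multiple_mem: "a \<in> multM S h \<Longrightarrow> a + j * e \<in> multM S (h + j)"
  using multM_add multiple_mem by blast

text \<open>The \<open>h\<close> with \<open>s \<in> multM S h\<close> form an initial segment,
  bounded by \<open>s\<close> since each nonzero summand is at least 1. Its largest element is the
  order.\<close>

lemma multM_sg_ord:
  assumes "s \<in> S"
  shows "s \<in> multM S (sg_ord S s) \<and> s \<notin> multM S (Suc (sg_ord S s))"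
  unfolding sg_ord_def
proof (rule theI')
  define h where "h = (GREATEST h. s \<in> multM S h)"
  have s0: "s \<in> multM S 0" using assms by simp
  have h: "s \<in> multM S h"
    unfolding h_def by (rule GreatestI_nat[where k = 0 and b = s]) (use s0 multM_ge in auto)
  have max: "k \<le> h" if "s \<in> multM S k" for k
    unfolding h_def by (rule Greatest_le_nat[where b = s]) (use that multM_ge in auto)
  show "\<exists>!h. s \<in> multM S h \<and> s \<notin> multM S (Suc h)"
  proof (rule ex1I[of _ h])
    show "s \<in> multM S h \<and> s \<notin> multM S (Suc h)" using h max[of "Suc h"] by auto
  next
    fix k assume k: "s \<in> multM S k \<and> s \<notin> multM S (Suc k)"
    then have "k \<le> h" using max by auto
    moreover have "\<not> Suc k \<le> h" using k h multM_antimono by blast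
    ultimately show "k = h" by simp
  qed
qed

lemma le_sg_ord_iff: "s \<in> S \<Longrightarrow> h \<le> sg_ord S s \<longleftrightarrow> s \<in> multM S h"
  using multM_sg_ord multM_antimono by (metis not_less_eq_eq subsetD)

text \<open>Among the prefix sums of \<open>e\<close> elements two agree modulo \<open>e\<close>, so a block of these elements sums to
  a multiple \<open>q * e\<close>; the block has at most \<open>q\<close> entries because each of them is at least \<open>e\<close>.\<close>
lemma multM_Suc_eq:
  assumes "e \<le> Suc h"
  shows "multM S (Suc h) = (+) e ` multM S h"
proof
  have "e \<in> multM S (Suc 0)" using e_mem e_pos by (simp add: multM_1)
  then show "(+) e ` multM S h \<subseteq> multM S (Suc h)"
    using multM_add[of e "Suc 0" _ h] by auto
next
  show "multM S (Suc h) \<subseteq> (+) e ` multM S h"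
  proof
    fix a assume "a \<in> multM S (Suc h)"
    then obtain xs where xs: "a = sum_list xs" "length xs = Suc h" "set xs \<subseteq> S - {0}"
      by (auto simp: multM_def)
    \<comment> \<open>There are \<open>e + 1\<close> prefixes, the empty one included, but only
      \<open>e\<close> residues; \<open>e \<le> Suc h\<close> ensures that \<open>xs\<close> is long
      enough for all of them.\<close>
    have "\<not> inj_on (\<lambda>i. sum_list (take i xs) mod e) {..e}"
    proof (rule pigeonhole)
      have "card ((\<lambda>i. sum_list (take i xs) mod e) ` {..e}) \<le> card {..<e}"
        by (rule card_mono) (use e_pos in auto)
      then show "card {..e} > card ((\<lambda>i. sum_list (take i xs) mod e) ` {..e})" by simp
    qed
    then obtain i j where ij: "i < j" "j \<le> e"
      "sum_list (take i xs) mod e = sum_list (take j xs) mod e"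
      unfolding inj_on_def by (metis atMost_iff linorder_neq_iff)
    define us vs ws where "us = take i xs" and "vs = drop i (take j xs)" and "ws = drop j xs"
    have us: "us = take i (take j xs)" using ij by (simp add: us_def)
    have split: "take j xs = us @ vs" unfolding us vs_def by (simp only: append_take_drop_id)
    then have xs_split: "xs = us @ vs @ ws"
      unfolding ws_def by (metis append_assoc append_take_drop_id)
    have len: "length us = i" "length vs = j - i" "length ws = Suc h - j"
      using xs ij assms by (auto simp: us_def vs_def ws_def)
    have "e dvd sum_list vs"
      using ij(3) mod_eq_dvd_iff_nat[of "sum_list us" "sum_list us + sum_list vs" e]
      by (simp add: split flip: us_def)
    then obtain q where q: "sum_list vs = e * q" by auto
    have vs_sub: "set vs \<subseteq> S - {0}" and us_sub: "set us \<subseteq> S - {0}" and ws_sub: "set ws \<subseteq> S - {0}"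
      using xs(3) xs_split by auto
    have "length ys * e \<le> sum_list ys" if "set ys \<subseteq> S - {0}" for ys
      using that by (induction ys) (auto intro: add_mono e_le)
    from this[OF vs_sub] have "(j - i) * e \<le> e * q" using q len by simp
    then have qji: "j - i \<le> q" using e_pos by (simp add: mult.commute)
    have "sum_list us + sum_list ws \<in> multM S (i + (Suc h - j))"
      using multM_add[OF sum_list_mem_multM[OF us_sub] sum_list_mem_multM[OF ws_sub]] len by simp
    \<comment> \<open>The block \<open>vs\<close> is replaced by \<open>q\<close> copies of
      \<open>e\<close>. One copy is set aside, and \<open>q \<ge> j - i\<close> leaves at least
      \<open>h\<close> summands.\<close>
    then have "sum_list us + sum_list ws + (q - 1) * e \<in> multM S (i + (Suc h - j) + (q - 1))"
      by (rule add_multiple_mem)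
    moreover have "h \<le> i + (Suc h - j) + (q - 1)" using qji ij assms by linarith
    ultimately have "sum_list us + sum_list ws + (q - 1) * e \<in> multM S h"
      using multM_antimono by blast
    moreover have "e * q = e + (q - 1) * e" using qji ij(1) by (cases q) auto
    then have "a = e + (sum_list us + sum_list ws + (q - 1) * e)"
      using xs(1) xs_split q by simp
    ultimately show "a \<in> (+) e ` multM S h" by blast
  qed
qed

text \<open>Iterates \<open>multM_Suc_eq\<close> from level \<open>e\<close> upwards. It extracts a
  prescribed multiple of \<open>e\<close> from any sum with enough summands.\<close>

lemma multM_Suc_shift:
  assumes "a \<in> multM S (e + j)"
  obtains b where "b \<in> multM S e" "a = b + j * e"
proof -
  have "multM S (e + j) = (\<lambda>b. b + j * e) ` multM S e"
  proof (induction j)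
    case (Suc j)
    then show ?case using multM_Suc_eq[of "e + j"] by (simp add: image_image ac_simps)
  qed simp
  then show ?thesis using assms that by blast
qed

section \<open>The Apery set and its maximal elements\<close>

lemma Apery_mem:
  assumes "s \<in> S" "s \<notin> (+) e ` S"
  shows "s \<in> Apery S e"
proof -
  have "(LEAST x. x \<in> S \<and> x mod e = (s mod e) mod e) = s"
  proof (rule Least_equality)
    fix y assume y: "y \<in> S \<and> y mod e = (s mod e) mod e"
    show "s \<le> y"
    proof (rule ccontr)
      assume "\<not> s \<le> y"
      then have "e dvd s - y" using y mod_eq_dvd_iff_nat[of y s e] by simp
      then obtain q where "s - y = e * q" by (rule dvdE)
      then have q: "s = y + e * q" using \<open>\<not> s \<le> y\<close> by linarith
      with \<open>\<not> s \<le> y\<close> obtain p where "q = Suc p" by (cases q) auto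
      then have "s = e + (p * e + y)" using q by (simp add: mult.commute)
      moreover have "p * e + y \<in> S" using multiple_mem[of p] multM_subset y add_mem by blast
      ultimately show False using assms(2) by blast
    qed
  qed (use assms in simp)
  then show ?thesis unfolding Apery_def using e_pos by (intro image_eqI[of _ _ "s mod e"]) auto
qed

text \<open>Subtract \<open>e\<close> as long as the result stays in \<open>S\<close>; this stops
  because \<open>e\<close> is positive.\<close>

lemma Apery_decomp:
  assumes "s \<in> S"
  obtains w k where "w \<in> S" "w \<notin> (+) e ` S" "s = w + k * e"
  using assms
proof (induction s arbitrary: thesis rule: less_induct)
  case (less s)
  show ?case
  proof (cases "s \<in> (+) e ` S")
    case True
    then obtain s' where s': "s = e + s'" "s' \<in> S" by auto
    obtain w k where "w \<in> S" "w \<notin> (+) e ` S" "s' = w + k * e"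
      using less.IH[of s'] s' e_pos by auto
    then show ?thesis using less.prems(1)[of w "Suc k"] s' by simp
  next
    case False
    then show ?thesis using less.prems(1)[of s 0] less.prems(2) by simp
  qed
qed

text \<open>An Apery element of largest order is maximal: additivity of orders forces a further
  summand to have order 0, hence to be 0. Membership in \<open>S\<close> is assumed separately
  because in this locale a residue class may miss \<open>S\<close>, and \<open>LEAST\<close> is then
  unspecified.\<close>

lemma ex_maxAp:
  assumes "w \<in> Apery S e" "w \<in> S"
  obtains v where "v \<in> maxAp S e" "sg_ord S w \<le> sg_ord S v"
proof -
  have fin: "finite (Apery S e \<inter> S)" by (simp add: Apery_def)
  have "Max (sg_ord S ` (Apery S e \<inter> S)) \<in> sg_ord S ` (Apery S e \<inter> S)"
    by (rule Max_in) (use fin assms in auto)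
  then obtain v where v: "v \<in> Apery S e \<inter> S" "sg_ord S v = Max (sg_ord S ` (Apery S e \<inter> S))"
    by auto
  have max: "sg_ord S u \<le> sg_ord S v" if "u \<in> Apery S e \<inter> S" for u
    unfolding v(2) by (rule Max_ge) (use fin that in auto)
  have "u = v" if u: "u \<in> Apery S e" "leM S v u" for u
  proof -
    obtain s where s: "s \<in> S" "v + s = u" "sg_ord S v + sg_ord S s = sg_ord S u"
      using u by (auto simp: leM_def)
    have "u \<in> S" using s v add_mem by auto
    then have "sg_ord S s = 0" using s(3) max[of u] u by simp
    then have "s \<notin> multM S (Suc 0)" using multM_sg_ord[OF s(1)] by simp
    then show ?thesis using s multM_1 by auto
  qed
  then show ?thesis using that[of v] v max[of w] assms by (auto simp: maxAp_def)
qed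

text \<open>A nonzero \<open>s\<close> of order \<open>h + 1\<close> splits as \<open>x + b\<close>
  with \<open>b\<close> in \<open>multM S h\<close>. If adding \<open>x\<close> raises the order of
  \<open>w\<close> by at least 2, then \<open>w + s\<close> has order above the sum of the two
  orders, so \<open>leM\<close> cannot relate it to \<open>w\<close>.\<close>

lemma maxAp_if_no_ord_additive:
  assumes "w \<in> Apery S e" "w \<in> S"
    and "\<And>x. x \<in> S - {0} \<Longrightarrow> w + x \<in> multM S (sg_ord S w + 2)"
  shows "w \<in> maxAp S e"
proof -
  have "u = w" if u: "leM S w u" for u
  proof (rule ccontr)
    assume "u \<noteq> w"
    obtain s where s: "s \<in> S" "w + s = u" "sg_ord S w + sg_ord S s = sg_ord S u"
      using u by (auto simp: leM_def)
    have "s \<in> multM S (Suc 0)" using s \<open>u \<noteq> w\<close> multM_1 by auto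
    then obtain h where h: "sg_ord S s = Suc h"
      using le_sg_ord_iff[OF s(1), of "Suc 0"] by (cases "sg_ord S s") auto
    then have "s \<in> multM S (Suc h)" using multM_sg_ord[OF s(1)] by simp
    then obtain x b where xb: "x \<in> S - {0}" "b \<in> multM S h" "s = x + b"
      by (rule multM_Suc_split)
    have "u \<in> multM S (sg_ord S w + 2 + h)"
      using multM_add[OF assms(3)[OF xb(1)] xb(2)] s xb by (simp add: add.assoc)
    then have "sg_ord S w + 2 + h \<le> sg_ord S u"
      using le_sg_ord_iff[of u] multM_subset by blast
    then show False using s h by simp
  qed
  then show ?thesis using assms by (auto simp: maxAp_def)
qed

text \<open>\<open>no_torsion\<close> is the Buchsbaum condition on initial forms of monomials: if the initial form of
  \<open>t^w\<close> is annihilated by a power of that of \<open>t^e\<close>, then it is annihilated by every \<open>t^x\<close>.\<close>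
lemma multM_Suc_eq_of_pure:
  assumes pure: "M_pure S e"
    and no_torsion: "\<And>w a j x. w \<in> multM S a \<Longrightarrow> w + j * e \<in> multM S (a + j + 1) \<Longrightarrow>
      x \<in> S - {0} \<Longrightarrow> w + x \<in> multM S (a + 2)"
    and nil: "multM S (Suc d) \<subseteq> (+) e ` S"
    and not_nil: "\<not> multM S d \<subseteq> (+) e ` S"
  shows "multM S (Suc d) = (+) e ` multM S d"
proof
  show "(+) e ` multM S d \<subseteq> multM S (Suc d)"
    using add_multiple_mem[of _ d 1] by (auto simp: add.commute)
  \<comment> \<open>Failure at \<open>d\<close> yields an Apery element of order at least
    \<open>d\<close>; a maximal one above it fixes a lower bound for the common order of all of
    \<open>maxAp S e\<close>.\<close>
  obtain w0 where w0: "w0 \<in> multM S d" "w0 \<notin> (+) e ` S" using not_nil by auto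
  then have "w0 \<in> S" using multM_subset by auto
  then obtain v where v: "v \<in> maxAp S e" "d \<le> sg_ord S v"
    using ex_maxAp[OF Apery_mem] w0 le_sg_ord_iff le_trans by metis
  show "multM S (Suc d) \<subseteq> (+) e ` multM S d"
  proof
    fix s assume s: "s \<in> multM S (Suc d)"
    then have "s \<in> S" "s \<in> (+) e ` S" using multM_subset nil by auto
    then obtain w k where w: "w \<in> S" "w \<notin> (+) e ` S" "s = w + k * e"
      using Apery_decomp by metis
    then obtain k' where k: "k = Suc k'" using \<open>s \<in> (+) e ` S\<close> by (cases k) auto
    show "s \<in> (+) e ` multM S d"
    proof (rule ccontr)
      assume "s \<notin> (+) e ` multM S d"
      then have notin: "w + k' * e \<notin> multM S d" using w k by (auto simp: image_iff)
      define a where "a = sg_ord S w"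
      have wa: "w \<in> multM S a" using multM_sg_ord w a_def by blast
      then have "w + k' * e \<in> multM S (a + k')" by (rule add_multiple_mem)
      then have lt: "a + k' < d" using notin multM_antimono[of d "a + k'"] by force
      \<comment> \<open>As \<open>k = Suc k'\<close>, the bound \<open>a + k' < d\<close> reads
        \<open>a + k + 1 \<le> Suc d\<close>. So \<open>k * e\<close> raises the order of
        \<open>w\<close> by more than \<open>k\<close>, and \<open>no_torsion\<close>
        applies.\<close>
      then have "w + k * e \<in> multM S (a + k + 1)"
        using s w k multM_antimono[of "a + k + 1" "Suc d"] by auto
      then have "w \<in> maxAp S e"
        using maxAp_if_no_ord_additive[OF Apery_mem] w no_torsion[OF wa] a_def by blast
      then have "a = sg_ord S v" using pure v unfolding M_pure_def a_def by blast
      then show False using v lt by simp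
    qed
  qed
qed

lemma nilpotency_eq_reduction:
  assumes pure: "M_pure S e"
    and no_torsion: "\<And>w a j x. w \<in> multM S a \<Longrightarrow> w + j * e \<in> multM S (a + j + 1) \<Longrightarrow>
      x \<in> S - {0} \<Longrightarrow> w + x \<in> multM S (a + 2)"
  shows "(LEAST k. multM S (Suc k) \<subseteq> (+) e ` S) = (LEAST r. multM S (Suc r) = (+) e ` multM S r)"
    (is "(LEAST k. ?P k) = (LEAST r. ?Q r)")
proof (rule antisym)
  have imp: "?P r" if "?Q r" for r using that multM_subset by blast
  \<comment> \<open>The equality at index \<open>e\<close> shows that both minima are
    attained.\<close>
  have ex: "?Q e" by (rule multM_Suc_eq) simp
  show "(LEAST k. ?P k) \<le> (LEAST r. ?Q r)"
    by (rule Least_le, rule imp, rule LeastI[of ?Q, OF ex])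
  define d where "d = (LEAST k. ?P k)"
  have "?P d" unfolding d_def by (rule LeastI[of ?P, OF imp[OF ex]])
  moreover have "\<not> multM S d \<subseteq> (+) e ` S"
  proof (cases d)
    \<comment> \<open>For \<open>d = 0\<close> minimality gives nothing; here
      \<open>0 \<in> S\<close> lies outside \<open>e + S\<close>.\<close>
    case 0
    then show ?thesis using zero_mem e_pos by auto
  next
    case (Suc k)
    then show ?thesis using not_less_Least[of k ?P] d_def by auto
  qed
  ultimately have "?Q d" by (intro multM_Suc_eq_of_pure[OF pure no_torsion])
  then show "(LEAST r. ?Q r) \<le> (LEAST k. ?P k)" unfolding d_def by (rule Least_le)
qed

end

section \<open>Powers of the maximal ideal\<close>

text \<open>The powers of the maximal ideal and \<open>J\<close> all have this form, so comparing
  them reduces to comparing sets of exponents.\<close>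

definition fps_on :: "nat set \<Rightarrow> 'k::field fps set" where
  "fps_on T = {f. \<forall>i. fps_nth f i \<noteq> 0 \<longrightarrow> i \<in> T}"

lemma fps_on_zero: "0 \<in> fps_on T"
  and fps_on_add: "f \<in> fps_on T \<Longrightarrow> h \<in> fps_on T \<Longrightarrow> f + h \<in> fps_on T"
  and fps_on_diff: "f \<in> fps_on T \<Longrightarrow> h \<in> fps_on T \<Longrightarrow> f - h \<in> fps_on T"
  and fps_on_minus: "f \<in> fps_on T \<Longrightarrow> - f \<in> fps_on T"
  unfolding fps_on_def by auto (metis add_0, metis diff_self)

lemma fps_on_sum: "(\<And>i. i \<in> I \<Longrightarrow> f i \<in> fps_on T) \<Longrightarrow> sum f I \<in> fps_on T"
  by (induction I rule: infinite_finite_induct) (auto simp: fps_on_zero fps_on_add)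

lemma fps_on_mult:
  assumes "f \<in> fps_on T" "h \<in> fps_on U" "\<And>a b. a \<in> T \<Longrightarrow> b \<in> U \<Longrightarrow> a + b \<in> V"
  shows "f * h \<in> fps_on V"
  unfolding fps_on_def
proof (safe)
  fix i assume "fps_nth (f * h) i \<noteq> 0"
  then obtain j where "j \<le> i" "fps_nth f j * fps_nth h (i - j) \<noteq> 0"
    unfolding fps_mult_nth by (meson atLeastAtMost_iff sum.neutral)
  then show "i \<in> V" using assms(1,2) assms(3)[of j "i - j"] by (auto simp: fps_on_def)
qed

lemma fps_on_X_power: "(fps_X ^ s :: 'k::field fps) \<in> fps_on T \<longleftrightarrow> s \<in> T"
  by (auto simp: fps_on_def)

lemma fps_on_mono: "T \<subseteq> U \<Longrightarrow> fps_on T \<subseteq> fps_on U"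
  by (auto simp: fps_on_def)

text \<open>The monomials \<open>fps_X ^ s\<close> in \<open>fps_on T\<close> recover
  \<open>T\<close>.\<close>

lemma fps_on_subset_iff: "fps_on T \<subseteq> (fps_on U :: 'k::field fps set) \<longleftrightarrow> T \<subseteq> U"
  using fps_on_X_power fps_on_mono by blast

lemma fps_on_eq_iff: "fps_on T = (fps_on U :: 'k::field fps set) \<longleftrightarrow> T = U"
  by (simp add: set_eq_subset fps_on_subset_iff)

lemma fps_on_shift: "(*) (fps_X ^ e) ` fps_on T = (fps_on ((+) e ` T) :: 'k::field fps set)"
proof
  show "(*) (fps_X ^ e) ` fps_on T \<subseteq> (fps_on ((+) e ` T) :: 'k fps set)"
    by (auto intro!: fps_on_mult[of _ "{e}" _ T] simp: fps_on_X_power)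
  show "(fps_on ((+) e ` T) :: 'k fps set) \<subseteq> (*) (fps_X ^ e) ` fps_on T"
  proof
    fix f :: "'k fps" assume f: "f \<in> fps_on ((+) e ` T)"
    define h where "h = Abs_fps (\<lambda>i. fps_nth f (e + i))"
    have "f = fps_X ^ e * h"
      using f by (force simp: fps_eq_iff fps_X_power_mult_nth h_def fps_on_def)
    moreover have "h \<in> fps_on T" using f by (auto simp: h_def fps_on_def)
    ultimately show "f \<in> (*) (fps_X ^ e) ` fps_on T" by blast
  qed
qed

text \<open>For each \<open>a\<close> in turn, all coefficients at exponents in \<open>a + T\<close>
  are moved into \<open>F a\<close>; the rest is supported on sums with the remaining elements of
  \<open>A\<close>. A series of possibly infinite support thus becomes a finite combination of
  monomials, as ideal generation requires.\<close>

lemma fps_on_decomp: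
  fixes f :: "'k::field fps"
  assumes "finite A" "f \<in> fps_on {a + b | a b. a \<in> A \<and> b \<in> T}"
  obtains F where "f = (\<Sum>a\<in>A. fps_X ^ a * F a)" "\<And>a. F a \<in> fps_on T"
  using assms
proof (induction A arbitrary: f thesis rule: finite_induct)
  case empty
  then have "f = 0" by (auto simp: fps_on_def fps_eq_iff)
  then show ?case using empty(1)[of "\<lambda>_. 0"] by (simp add: fps_on_zero)
next
  case (insert a A)
  define f1 where "f1 = Abs_fps (\<lambda>i. if i \<in> T then fps_nth f (a + i) else 0)"
  have "f - fps_X ^ a * f1 \<in> fps_on {a + b | a b. a \<in> A \<and> b \<in> T}"
    unfolding fps_on_def
  proof (safe)
    fix i assume i: "fps_nth (f - fps_X ^ a * f1) i \<noteq> 0"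
    show "\<exists>c b. i = c + b \<and> c \<in> A \<and> b \<in> T"
    proof (rule ccontr)
      assume "\<not> ?thesis"
      then have no: "\<not> (\<exists>c b. i = c + b \<and> c \<in> A \<and> b \<in> T)" .
      show False
      proof (cases "fps_nth f i = 0")
        case True
        then show False using i by (auto simp: fps_X_power_mult_nth f1_def split: if_splits)
      next
        case False
        then obtain b where "i = a + b" "b \<in> T" using insert.prems(2) no by (auto simp: fps_on_def)
        then show False using i by (simp add: fps_X_power_mult_nth f1_def)
      qed
    qed
  qed
  then obtain F where F: "f - fps_X ^ a * f1 = (\<Sum>a\<in>A. fps_X ^ a * F a)" "\<And>a. F a \<in> fps_on T"
    using insert.IH by blast
  have f1: "f1 \<in> fps_on T" by (auto simp: fps_on_def f1_def)
  have "f = fps_X ^ a * f1 + (\<Sum>a\<in>A. fps_X ^ a * F a)"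
    using F(1) by (simp add: algebra_simps)
  also have "(\<Sum>a\<in>A. fps_X ^ a * F a) = (\<Sum>c\<in>A. fps_X ^ c * (F(a := f1)) c)"
    by (rule sum.cong) (use insert.hyps in auto)
  finally show ?case
    using insert.prems(1)[of "F(a := f1)"] insert.hyps F(2) f1 by simp
qed

section \<open>The semigroup ring and its ideals given by exponent sets\<close>

lemma semigroup_ring_simps [simp]:
  "carrier (semigroup_ring S) = fps_on S"
  "x \<otimes>\<^bsub>semigroup_ring S\<^esub> y = x * y" "x \<oplus>\<^bsub>semigroup_ring S\<^esub> y = x + y"
  "\<one>\<^bsub>semigroup_ring S\<^esub> = 1" "\<zero>\<^bsub>semigroup_ring S\<^esub> = 0"
  by (auto simp: semigroup_ring_def fps_on_def)

lemma coset_semigroup_ring: "I +>\<^bsub>semigroup_ring S\<^esub> x = (\<lambda>a. a + x) ` I"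
  by (auto simp: a_r_coset_def' semigroup_ring_def)

lemma ideal_prod_sum:
  assumes "finite I" "\<And>i. i \<in> I \<Longrightarrow> f i \<in> ideal_prod (semigroup_ring S) U V" "0 \<in> U" "0 \<in> V"
  shows "sum f I \<in> ideal_prod (semigroup_ring S) U V"
  using assms
proof (induction I rule: finite_induct)
  case empty
  then show ?case using ideal_prod.prod[of 0 U 0 V "semigroup_ring S"] by simp
next
  case (insert i I)
  then show ?case using ideal_prod.sum[of "f i" "semigroup_ring S" U V "sum f I"] by simp
qed

locale generated_semigroup = pointed_semigroup +
  fixes A :: "nat set"
  assumes finite_gens: "finite A" and gens_subset: "A \<subseteq> S - {0}"
    and gens: "\<And>s. s \<in> S - {0} \<Longrightarrow> \<exists>a\<in>A. \<exists>b\<in>S. s = a + b"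
begin

text \<open>Split a generator off one summand and let the other summands absorb what remains.
  Together with \<open>fps_on_decomp\<close> this yields finite generation of the ideal
  powers.\<close>

lemma multM_Suc_gens: "multM S (Suc h) = {a + b | a b. a \<in> A \<and> b \<in> multM S h}"
proof
  show "multM S (Suc h) \<subseteq> {a + b | a b. a \<in> A \<and> b \<in> multM S h}"
  proof
    fix s assume "s \<in> multM S (Suc h)"
    then obtain x b where xb: "x \<in> S - {0}" "b \<in> multM S h" "s = x + b"
      by (rule multM_Suc_split)
    obtain a c where ac: "a \<in> A" "c \<in> S" "x = a + c" using gens[OF xb(1)] by blast
    have "s = a + (c + b)" using xb ac by simp
    then show "s \<in> {a + b | a b. a \<in> A \<and> b \<in> multM S h}"
      using multM_absorb[OF ac(2) xb(2)] ac(1) by blast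
  qed
  show "{a + b | a b. a \<in> A \<and> b \<in> multM S h} \<subseteq> multM S (Suc h)"
    using multM_add[of _ "Suc 0" _ h] gens_subset unfolding multM_1 by fastforce
qed

lemma cring_semigroup_ring: "cring (semigroup_ring S :: 'k::field fps ring)"
proof (rule cringI)
  show "abelian_group (semigroup_ring S :: 'k fps ring)"
    by (rule abelian_groupI)
      (auto simp: fps_on_add fps_on_zero intro!: bexI[of _ "- _"] fps_on_minus)
  show "Group.comm_monoid (semigroup_ring S :: 'k fps ring)"
    using fps_on_X_power[of 0 S] zero_mem
    by unfold_locales (auto intro: fps_on_mult add_mem)
qed (auto simp: algebra_simps)

lemma ideal_fps_on:
  assumes "T \<subseteq> S" "\<And>a b. a \<in> S \<Longrightarrow> b \<in> T \<Longrightarrow> a + b \<in> T"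
  shows "ideal (fps_on T :: 'k::field fps set) (semigroup_ring S)"
proof -
  interpret cring "semigroup_ring S :: 'k fps ring" by (rule cring_semigroup_ring)
  have sub: "fps_on T \<subseteq> (fps_on S :: 'k fps set)" by (rule fps_on_mono[OF assms(1)])
  have minus: "\<ominus>\<^bsub>semigroup_ring S\<^esub> f = - f" if "f \<in> fps_on T" for f :: "'k fps"
    by (rule minus_equality) (use that sub fps_on_minus in auto)
  have "subgroup (fps_on T) (add_monoid (semigroup_ring S :: 'k fps ring))"
    by (rule subgroup.intro)
      (use sub minus in \<open>auto simp: fps_on_add fps_on_zero fps_on_minus a_inv_def\<close>)
  moreover have "x * a \<in> fps_on T" if "a \<in> fps_on T" "x \<in> fps_on S" for a x :: "'k fps"
    by (rule fps_on_mult[OF that(2,1)]) (rule assms(2))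
  ultimately show ?thesis
    by (intro idealI) (auto simp: ring_axioms mult.commute)
qed

lemma ideal_multM: "ideal (fps_on (multM S h) :: 'k::field fps set) (semigroup_ring S)"
  by (rule ideal_fps_on) (use multM_subset multM_absorb in auto)

lemma fps_on_multM_subset: "fps_on (multM S h) \<subseteq> fps_on S"
  by (rule fps_on_mono[OF multM_subset])

lemma genideal_gens:
  "Idl\<^bsub>semigroup_ring S\<^esub> ((\<lambda>a. fps_X ^ a) ` A) = (fps_on (multM S (Suc 0)) :: 'k::field fps set)"
    (is "Idl\<^bsub>?R\<^esub> ?B = ?P")
proof -
  interpret cring ?R by (rule cring_semigroup_ring)
  have B: "?B \<subseteq> ?P" using gens_subset by (auto simp: fps_on_X_power multM_1)
  then have "?B \<subseteq> carrier ?R" using fps_on_multM_subset by simp (rule subset_trans)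
  then interpret I: ideal "Idl\<^bsub>?R\<^esub> ?B" ?R by (rule genideal_ideal)
  have gen: "?B \<subseteq> Idl\<^bsub>?R\<^esub> ?B" by (rule genideal_self) fact
  show ?thesis
  proof
    show "Idl\<^bsub>?R\<^esub> ?B \<subseteq> ?P" by (rule genideal_minimal[OF ideal_multM B])
    show "?P \<subseteq> Idl\<^bsub>?R\<^esub> ?B"
    proof
      fix f assume "f \<in> ?P"
      then obtain F where F: "f = (\<Sum>a\<in>A. fps_X ^ a * F a)" "\<And>a. F a \<in> fps_on S"
        using fps_on_decomp[OF finite_gens, of f S] multM_Suc_gens[of 0] by auto
      have "fps_X ^ a * F a \<in> Idl\<^bsub>?R\<^esub> ?B" if "a \<in> A" for a
        using I.I_r_closed[of "fps_X ^ a" "F a"] gen F(2) that by auto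
      note mem = this
      have "(\<Sum>a\<in>A'. fps_X ^ a * F a) \<in> Idl\<^bsub>?R\<^esub> ?B" if "A' \<subseteq> A" for A'
        using finite_subset[OF that finite_gens] that
        by (induction A' rule: finite_induct) (use I.zero_closed I.a_closed mem in auto)
      then show "f \<in> Idl\<^bsub>?R\<^esub> ?B" using F(1) by blast
    qed
  qed
qed

lemma ideal_pow_multM:
  "ideal_pow (semigroup_ring S) (fps_on (multM S (Suc 0))) h = (fps_on (multM S h) :: 'k::field fps set)"
proof (induction h)
  case 0
  \<comment> \<open>The zeroth power is the whole ring, in accordance with the convention
    \<open>multM S 0 = S\<close>.\<close>
  then show ?case by (simp add: nat_pow_def ideals_set_def)
next
  case (Suc h)
  let ?R = "semigroup_ring S :: 'k fps ring"
  let ?P = "\<lambda>h. fps_on (multM S h) :: 'k fps set"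
  have "ideal_pow ?R (?P (Suc 0)) (Suc h) = ideal_prod ?R (?P h) (?P (Suc 0))"
    using Suc by (simp add: nat_pow_def ideals_set_def)
  also have "\<dots> = ?P (Suc h)"
  proof
    show "ideal_prod ?R (?P h) (?P (Suc 0)) \<subseteq> ?P (Suc h)"
    proof
      fix f assume "f \<in> ideal_prod ?R (?P h) (?P (Suc 0))"
      then show "f \<in> ?P (Suc h)"
      proof induction
        case (prod i j)
        have "i * j \<in> ?P (Suc h)"
          by (rule fps_on_mult[OF prod]) (use multM_add[of _ h _ "Suc 0"] in simp)
        then show ?case by simp
      qed (simp add: fps_on_add)
    qed
    show "?P (Suc h) \<subseteq> ideal_prod ?R (?P h) (?P (Suc 0))"
    proof
      fix f assume "f \<in> ?P (Suc h)"
      then obtain F where F: "f = (\<Sum>a\<in>A. fps_X ^ a * F a)" "\<And>a. F a \<in> ?P h"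
        using fps_on_decomp[OF finite_gens, of f "multM S h"] multM_Suc_gens[of h] by auto
      have "fps_X ^ a * F a \<in> ideal_prod ?R (?P h) (?P (Suc 0))" if "a \<in> A" for a
      proof -
        have "fps_X ^ a \<in> ?P (Suc 0)" using that gens_subset by (auto simp: fps_on_X_power multM_1)
        then have "F a \<otimes>\<^bsub>?R\<^esub> fps_X ^ a \<in> ideal_prod ?R (?P h) (?P (Suc 0))"
          by (rule ideal_prod.prod[OF F(2)])
        then show ?thesis by (simp add: mult.commute)
      qed
      then show "f \<in> ideal_prod ?R (?P h) (?P (Suc 0))"
        unfolding F(1) by (intro ideal_prod_sum finite_gens fps_on_zero) auto
    qed
  qed
  finally show ?case .
qed


section \<open>The associated graded ring\<close>

abbreviation max_pow :: "nat \<Rightarrow> 'k::field fps set" where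
  "max_pow h \<equiv> fps_on (multM S h)"

abbreviation graded_ring :: "(nat \<Rightarrow> 'k::field fps set) ring" where
  "graded_ring \<equiv> assoc_graded (semigroup_ring S) (max_pow (Suc 0))"

text \<open>A homogeneous component is given by a representative \<open>F i\<close>, meant to lie in
  \<open>max_pow i\<close>. Computing with such families replaces computing with cosets.\<close>

definition initial_forms :: "(nat \<Rightarrow> 'k::field fps) \<Rightarrow> nat \<Rightarrow> 'k fps set" where
  "initial_forms F i = max_pow (Suc i) +>\<^bsub>semigroup_ring S\<^esub> F i"

lemma max_pow_Suc_subset: "max_pow (Suc h) \<subseteq> max_pow h"
  by (rule fps_on_mono[OF multM_Suc_subset])

lemma max_pow_mult: "f \<in> max_pow h \<Longrightarrow> g \<in> max_pow k \<Longrightarrow> f * g \<in> max_pow (h + k)"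
  by (erule (1) fps_on_mult) (rule multM_add)

lemma coset_eq_iff:
  fixes f :: "'k::field fps"
  shows "max_pow h +>\<^bsub>semigroup_ring S\<^esub> f = max_pow h +>\<^bsub>semigroup_ring S\<^esub> f' \<longleftrightarrow> f - f' \<in> max_pow h"
proof
  assume eq: "max_pow h +>\<^bsub>semigroup_ring S\<^esub> f = max_pow h +>\<^bsub>semigroup_ring S\<^esub> f'"
  have "f \<in> max_pow h +>\<^bsub>semigroup_ring S\<^esub> f"
    unfolding coset_semigroup_ring by (rule image_eqI[of _ _ 0]) (auto simp: fps_on_zero)
  then have "f \<in> max_pow h +>\<^bsub>semigroup_ring S\<^esub> f'" using eq by simp
  then show "f - f' \<in> max_pow h" unfolding coset_semigroup_ring by auto
next
  assume d: "f - f' \<in> max_pow h"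
  have "a + f \<in> (\<lambda>a. a + f') ` max_pow h" if "a \<in> max_pow h" for a
    by (rule image_eqI[of _ _ "a + (f - f')"]) (use that d fps_on_add in auto)
  moreover have "a + f' \<in> (\<lambda>a. a + f) ` max_pow h" if "a \<in> max_pow h" for a
    by (rule image_eqI[of _ _ "a - (f - f')"]) (use that d fps_on_diff in auto)
  ultimately show "max_pow h +>\<^bsub>semigroup_ring S\<^esub> f = max_pow h +>\<^bsub>semigroup_ring S\<^esub> f'"
    unfolding coset_semigroup_ring by blast
qed

lemma coset_eq_self_iff:
  "max_pow h +>\<^bsub>semigroup_ring S\<^esub> f = max_pow h \<longleftrightarrow> (f :: 'k::field fps) \<in> max_pow h"
proof -
  have "max_pow h +>\<^bsub>semigroup_ring S\<^esub> (0 :: 'k fps) = max_pow h"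
    by (simp add: coset_semigroup_ring)
  then show ?thesis using coset_eq_iff[of h f 0] by simp
qed

text \<open>Changing representatives alters the product by \<open>p * q + p * g + f * q\<close>,
  which lies one power deeper.\<close>

lemma rcoset_mult_max_pow:
  fixes f g :: "'k::field fps"
  assumes f: "f \<in> max_pow h" and g: "g \<in> max_pow k"
  shows "rcoset_mult (semigroup_ring S) (max_pow (Suc (h + k)))
      (max_pow (Suc h) +>\<^bsub>semigroup_ring S\<^esub> f) (max_pow (Suc k) +>\<^bsub>semigroup_ring S\<^esub> g)
    = max_pow (Suc (h + k)) +>\<^bsub>semigroup_ring S\<^esub> (f * g)"
proof -
  have "max_pow (Suc (h + k)) +>\<^bsub>semigroup_ring S\<^esub> ((p + f) * (q + g))
      = max_pow (Suc (h + k)) +>\<^bsub>semigroup_ring S\<^esub> (f * g)"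
    if p: "p \<in> max_pow (Suc h)" and q: "q \<in> max_pow (Suc k)" for p q
  proof -
    have "p * q + p * g + f * q \<in> max_pow (Suc (h + k))"
      using max_pow_mult[OF p, of q k] max_pow_mult[OF p g] max_pow_mult[OF f q]
        max_pow_Suc_subset q by (auto intro!: fps_on_add)
    then show ?thesis unfolding coset_eq_iff by (simp add: algebra_simps)
  qed
  \<comment> \<open>\<open>rcoset_mult\<close> is a union over representatives; the constant value
    survives only because the index sets are nonempty.\<close>
  moreover have "max_pow (Suc h) \<noteq> ({} :: 'k fps set)" for h using fps_on_zero by blast
  ultimately show ?thesis
    unfolding rcoset_mult_def coset_semigroup_ring[where I = "max_pow (Suc h)"]
      coset_semigroup_ring[where I = "max_pow (Suc k)"] by simp
qed

lemma coset_sum: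
  assumes "finite I" "\<And>i. i \<in> I \<Longrightarrow> f i \<in> fps_on S"
  shows "finsum (semigroup_ring S Quot max_pow h) (\<lambda>i. max_pow h +>\<^bsub>semigroup_ring S\<^esub> f i) I
    = max_pow h +>\<^bsub>semigroup_ring S\<^esub> (sum f I :: 'k::field fps)"
  using assms
proof (induction I rule: finite_induct)
  interpret I: ideal "max_pow h :: 'k fps set" "semigroup_ring S" by (rule ideal_multM)
  interpret Q: ring "semigroup_ring S Quot (max_pow h :: 'k fps set)" by (rule I.quotient_is_ring)
  note hom = ring_hom_closed[OF I.rcos_ring_hom] ring_hom_add[OF I.rcos_ring_hom]
  {
    case empty
    have "\<zero>\<^bsub>semigroup_ring S Quot max_pow h\<^esub> = (max_pow h :: 'k fps set)"
      by (simp add: FactRing_def)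
    then show ?case by (simp add: coset_semigroup_ring)
  next
    case (insert i I)
    have "sum f I \<in> fps_on S" using insert by (intro fps_on_sum) auto
    then show ?case
      using insert hom(1) hom(2)[of "f i" "sum f I"] by (subst Q.finsum_insert) auto
  }
qed

text \<open>Multiplication in the graded ring becomes the Cauchy product of representing
  families.\<close>

lemma initial_forms_mult:
  fixes F H :: "nat \<Rightarrow> 'k::field fps"
  assumes "\<And>i. F i \<in> max_pow i" "\<And>i. H i \<in> max_pow i"
  shows "initial_forms F \<otimes>\<^bsub>graded_ring\<^esub> initial_forms H
    = initial_forms (\<lambda>k. \<Sum>i\<le>k. F i * H (k - i))"
proof
  fix k
  have mem: "F i * H (k - i) \<in> fps_on S" for i
    using max_pow_mult[OF assms(1)[of i] assms(2)[of "k - i"]] fps_on_multM_subset by blast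
  interpret I: ideal "max_pow (Suc k) :: 'k fps set" "semigroup_ring S" by (rule ideal_multM)
  interpret Q: ring "semigroup_ring S Quot (max_pow (Suc k) :: 'k fps set)"
    by (rule I.quotient_is_ring)
  have "(initial_forms F \<otimes>\<^bsub>graded_ring\<^esub> initial_forms H) k
    = finsum (semigroup_ring S Quot max_pow (Suc k))
       (\<lambda>i. rcoset_mult (semigroup_ring S) (max_pow (Suc k)) (initial_forms F i) (initial_forms H (k - i))) {..k}"
    by (simp add: assoc_graded_def ideal_pow_multM del: nat_pow_Suc)
  also have "\<dots> = finsum (semigroup_ring S Quot max_pow (Suc k))
       (\<lambda>i. max_pow (Suc k) +>\<^bsub>semigroup_ring S\<^esub> (F i * H (k - i))) {..k}"
  proof (rule Q.finsum_cong')
    show "(\<lambda>i. max_pow (Suc k) +>\<^bsub>semigroup_ring S\<^esub> (F i * H (k - i)))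
        \<in> {..k} \<rightarrow> carrier (semigroup_ring S Quot max_pow (Suc k))"
      using ring_hom_closed[OF I.rcos_ring_hom] mem by auto
    show "rcoset_mult (semigroup_ring S) (max_pow (Suc k)) (initial_forms F i) (initial_forms H (k - i))
        = max_pow (Suc k) +>\<^bsub>semigroup_ring S\<^esub> (F i * H (k - i))" if "i \<in> {..k}" for i
      using rcoset_mult_max_pow[OF assms(1)[of i] assms(2)[of "k - i"]] that
      by (simp add: initial_forms_def)
  qed simp
  also have "\<dots> = initial_forms (\<lambda>k. \<Sum>i\<le>k. F i * H (k - i)) k"
    unfolding initial_forms_def by (rule coset_sum) (use mem in auto)
  finally show "(initial_forms F \<otimes>\<^bsub>graded_ring\<^esub> initial_forms H) k
    = initial_forms (\<lambda>k. \<Sum>i\<le>k. F i * H (k - i)) k" .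
qed

lemma initial_forms_add:
  fixes F H :: "nat \<Rightarrow> 'k::field fps"
  assumes "\<And>i. F i \<in> max_pow i" "\<And>i. H i \<in> max_pow i"
  shows "initial_forms F \<oplus>\<^bsub>graded_ring\<^esub> initial_forms H = initial_forms (\<lambda>i. F i + H i)"
proof
  fix i
  interpret I: ideal "max_pow (Suc i) :: 'k fps set" "semigroup_ring S" by (rule ideal_multM)
  have "F i \<in> fps_on S" "H i \<in> fps_on S" using assms[of i] fps_on_multM_subset by blast+
  then show "(initial_forms F \<oplus>\<^bsub>graded_ring\<^esub> initial_forms H) i = initial_forms (\<lambda>i. F i + H i) i"
    using I.a_rcos_sum[of "F i" "H i"] by (simp add: assoc_graded_def initial_forms_def)
qed

lemma carrier_graded_ring:
  "carrier graded_ring = {initial_forms F | F :: nat \<Rightarrow> 'k::field fps.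
     (\<forall>i. F i \<in> max_pow i) \<and> finite {i. F i \<notin> max_pow (Suc i)}}"
proof -
  have "x \<in> carrier graded_ring \<longleftrightarrow> (\<forall>i. \<exists>f. f \<in> max_pow i \<and> x i = max_pow (Suc i) +>\<^bsub>semigroup_ring S\<^esub> f)
     \<and> finite {i. x i \<noteq> max_pow (Suc i)}" for x :: "nat \<Rightarrow> 'k fps set"
    by (auto simp: assoc_graded_def ideal_pow_multM simp del: nat_pow_Suc)
  also have "\<dots> x \<longleftrightarrow> (\<exists>F. x = initial_forms F \<and> (\<forall>i. F i \<in> max_pow i)
     \<and> finite {i. F i \<notin> max_pow (Suc i)})" for x :: "nat \<Rightarrow> 'k fps set"
    unfolding choice_iff by (auto simp: initial_forms_def fun_eq_iff coset_eq_self_iff)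
  finally show ?thesis by blast
qed

lemma zero_graded_ring: "\<zero>\<^bsub>graded_ring\<^esub> i = (max_pow (Suc i) :: 'k::field fps set)"
  by (simp add: assoc_graded_def ideal_pow_multM del: nat_pow_Suc)

lemma initial_forms_eq_zero_iff:
  "initial_forms F = \<zero>\<^bsub>graded_ring\<^esub> \<longleftrightarrow> (\<forall>i. (F i :: 'k::field fps) \<in> max_pow (Suc i))"
  by (auto simp: fun_eq_iff zero_graded_ring initial_forms_def coset_eq_self_iff)

text \<open>The \<open>k\<close>-th power of the homogeneous maximal ideal has no components below
  degree \<open>k\<close>. In a product, a term of degree at most \<open>k\<close> has either a left
  factor of degree below \<open>k\<close> or a right factor of degree 0, and that factor
  vanishes.\<close>

lemma ideal_pow_homogeneous:
  fixes y :: "nat \<Rightarrow> 'k::field fps set"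
  assumes "y \<in> ideal_pow graded_ring (homogeneous_max_ideal (semigroup_ring S) (max_pow (Suc 0))) k"
  shows "\<exists>F. y = initial_forms F \<and> (\<forall>i. F i \<in> max_pow i) \<and> (\<forall>i<k. F i \<in> max_pow (Suc i))"
  using assms
proof (induction k arbitrary: y)
  case 0
  then show ?case by (auto simp: nat_pow_def ideals_set_def carrier_graded_ring)
next
  case (Suc k)
  let ?M = "homogeneous_max_ideal (semigroup_ring S) (max_pow (Suc 0)) :: (nat \<Rightarrow> 'k fps set) set"
  have "y \<in> ideal_prod graded_ring (ideal_pow graded_ring ?M k) ?M"
    using Suc.prems by (simp add: nat_pow_def ideals_set_def)
  then show ?case
  proof induction
    case (prod u v)
    obtain F where F: "u = initial_forms F" "\<And>i. F i \<in> max_pow i" "\<And>i. i < k \<Longrightarrow> F i \<in> max_pow (Suc i)"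
      using Suc.IH[OF prod(1)] by blast
    obtain H where H: "v = initial_forms H" "\<And>i. H i \<in> max_pow i"
      using prod(2) by (auto simp: homogeneous_max_ideal_def carrier_graded_ring)
    have H0: "H 0 \<in> max_pow (Suc 0)"
      using prod(2) unfolding homogeneous_max_ideal_def
      by (simp add: H(1) zero_graded_ring initial_forms_def coset_eq_self_iff)
    have "F j * H (i - j) \<in> max_pow i" if "j \<le> i" for i j
      using max_pow_mult[OF F(2)[of j] H(2)[of "i - j"]] that by simp
    moreover have "F j * H (i - j) \<in> max_pow (Suc i)" if "j \<le> i" "i < Suc k" for i j
    proof (cases "j < k")
      case True
      then show ?thesis using max_pow_mult[OF F(3)[OF True] H(2)[of "i - j"]] that by simp
    next
      case False
      then have "j = i" using that by simp
      then show ?thesis using max_pow_mult[OF F(2)[of i] H0] by simp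
    qed
    ultimately show ?case unfolding F(1) H(1) initial_forms_mult[OF F(2) H(2)]
      by (intro exI[of _ "\<lambda>i. \<Sum>j\<le>i. F j * H (i - j)"]) (auto intro!: fps_on_sum)
  next
    case (sum u v)
    then obtain F H where F: "u = initial_forms F" "\<And>i. F i \<in> max_pow i" "\<And>i. i < Suc k \<Longrightarrow> F i \<in> max_pow (Suc i)"
      and H: "v = initial_forms H" "\<And>i. H i \<in> max_pow i" "\<And>i. i < Suc k \<Longrightarrow> H i \<in> max_pow (Suc i)"
      by blast
    show ?case unfolding F(1) H(1) initial_forms_add[OF F(2) H(2)]
      by (intro exI[of _ "\<lambda>i. F i + H i"]) (use F H in \<open>auto intro!: fps_on_add\<close>)
  qed
qed

text \<open>Represents the class of \<open>t^w\<close> in degree \<open>a\<close>. If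
  \<open>a\<close> is below the order of \<open>w\<close>, this class is zero.\<close>

definition monomial_family :: "nat \<Rightarrow> nat \<Rightarrow> nat \<Rightarrow> 'k::field fps" where
  "monomial_family a w i = (if i = a then fps_X ^ w else 0)"

lemma monomial_family_mem: "w \<in> multM S a \<Longrightarrow> monomial_family a w i \<in> max_pow i"
  by (simp add: monomial_family_def fps_on_zero fps_on_X_power)

lemma monomial_family_carrier:
  assumes "w \<in> multM S a"
  shows "initial_forms (monomial_family a w) \<in> carrier graded_ring"
proof -
  have "finite {i. monomial_family a w i \<notin> max_pow (Suc i)}"
    by (rule finite_subset[of _ "{a}"]) (auto simp: monomial_family_def fps_on_zero)
  then show ?thesis unfolding carrier_graded_ring using monomial_family_mem[OF assms] by blast
qed

text \<open>Passes from torsion under \<open>t^e\<close> to torsion under the homogeneous maximal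
  ideal. Below degree \<open>e + j\<close> the components of \<open>y\<close> vanish. From there on
  every exponent is \<open>b + (j + l) * e\<close> with \<open>b\<close> in
  \<open>multM S e\<close>, and its part \<open>j * e\<close> already lifts the order of
  \<open>w\<close> by one too many.\<close>

lemma monomial_annihilated:
  assumes w: "w \<in> multM S a" "w + j * e \<in> multM S (a + j + 1)"
  shows "initial_forms (monomial_family a w :: nat \<Rightarrow> 'k::field fps) \<in> ideal_annihilator graded_ring
    (ideal_pow graded_ring (homogeneous_max_ideal (semigroup_ring S) (max_pow (Suc 0))) (e + j))"
  unfolding ideal_annihilator_def
proof (intro CollectI conjI ballI monomial_family_carrier w(1))
  fix y :: "nat \<Rightarrow> 'k fps set"
  assume "y \<in> ideal_pow graded_ring (homogeneous_max_ideal (semigroup_ring S) (max_pow (Suc 0))) (e + j)"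
  then obtain F where F: "y = initial_forms F" "\<And>i. F i \<in> max_pow i"
    "\<And>i. i < e + j \<Longrightarrow> F i \<in> max_pow (Suc i)"
    using ideal_pow_homogeneous by blast
  have shift: "fps_X ^ w * F i \<in> max_pow (Suc (a + i))" for i
  proof (cases "i < e + j")
    case True
    then show ?thesis
      using max_pow_mult[of "fps_X ^ w" a, OF _ F(3)[OF True]] w by (simp add: fps_on_X_power)
  next
    case False
    then obtain l where l: "i = e + (j + l)" by (metis add.assoc le_Suc_ex not_less)
    have "w + v \<in> multM S (Suc (a + i))" if v: "v \<in> multM S i" for v
    proof -
      obtain b where b: "b \<in> multM S e" "v = b + (j + l) * e"
        using v multM_Suc_shift unfolding l by blast
      have "(w + j * e) + l * e + b \<in> multM S (a + j + 1 + l + e)"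
        by (intro multM_add[OF add_multiple_mem[OF w(2)] b(1)])
      then show ?thesis using b l by (simp add: algebra_simps)
    qed
    then show ?thesis
      by (intro fps_on_mult[of _ "{w}", OF _ F(2)]) (auto simp: fps_on_X_power)
  qed
  have "monomial_family a w i * F (k - i) \<in> max_pow (Suc k)" if "i \<le> k" for i k
    using shift[of "k - i"] that by (auto simp: monomial_family_def fps_on_zero)
  then show "initial_forms (monomial_family a w) \<otimes>\<^bsub>graded_ring\<^esub> y = \<zero>\<^bsub>graded_ring\<^esub>"
    unfolding F(1) initial_forms_mult[OF monomial_family_mem[OF w(1)] F(2)] initial_forms_eq_zero_iff
    by (auto intro!: fps_on_sum)
qed

text \<open>The classes of \<open>t^x\<close> in degree 1 and \<open>t^w\<close> in degree
  \<open>a\<close> multiply to the class of \<open>t^(w+x)\<close> in degree \<open>a + 1\<close>;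
  its vanishing is the claim.\<close>

lemma Buchsbaum_no_torsion:
  assumes buchsbaum: "graded_Buchsbaum (semigroup_ring S) (max_pow (Suc 0) :: 'k::field fps set)"
    and w: "w \<in> multM S a" "w + j * e \<in> multM S (a + j + 1)" and x: "x \<in> S - {0}"
  shows "w + x \<in> multM S (a + 2)"
proof -
  let ?G = "graded_ring :: (nat \<Rightarrow> 'k fps set) ring"
  let ?M = "homogeneous_max_ideal (semigroup_ring S) (max_pow (Suc 0)) :: (nat \<Rightarrow> 'k fps set) set"
  let ?u = "initial_forms (monomial_family a w) :: nat \<Rightarrow> 'k fps set"
  let ?v = "initial_forms (monomial_family (Suc 0) x) :: nat \<Rightarrow> 'k fps set"
  have x1: "x \<in> multM S (Suc 0)" using x multM_1 by simp
  have "?u \<in> local_cohomology0 ?G ?M"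
    unfolding local_cohomology0_def using monomial_annihilated[OF w, where 'k = 'k] e_pos
    \<comment> \<open>The union in \<open>local_cohomology0\<close> starts at exponent 1;
      \<open>e_pos\<close> makes \<open>e + j\<close> admissible even for
      \<open>j = 0\<close>.\<close>
    by (intro UN_I[of "e + j"]) auto
  moreover have "?v 0 = \<zero>\<^bsub>?G\<^esub> 0"
    unfolding zero_graded_ring by (simp add: initial_forms_def monomial_family_def coset_eq_self_iff fps_on_zero)
  then have "?v \<in> ?M"
    unfolding homogeneous_max_ideal_def using monomial_family_carrier[OF x1] by simp
  ultimately have "?v \<otimes>\<^bsub>?G\<^esub> ?u \<in> ideal_prod ?G ?M (local_cohomology0 ?G ?M)"
    by (intro ideal_prod.prod)
  then have "?v \<otimes>\<^bsub>?G\<^esub> ?u = \<zero>\<^bsub>?G\<^esub>"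
    using buchsbaum by (simp add: graded_Buchsbaum_def Let_def)
  then have "(\<Sum>i\<le>Suc a. monomial_family (Suc 0) x i * monomial_family a w (Suc a - i) :: 'k fps)
      \<in> max_pow (Suc (Suc a))"
    unfolding initial_forms_mult[OF monomial_family_mem[OF x1] monomial_family_mem[OF w(1)]]
      initial_forms_eq_zero_iff by blast
  also have "(\<Sum>i\<le>Suc a. monomial_family (Suc 0) x i * monomial_family a w (Suc a - i) :: 'k fps)
      = (\<Sum>i\<le>Suc a. if i = Suc 0 then fps_X ^ x * fps_X ^ w else 0)"
    by (rule sum.cong) (auto simp: monomial_family_def)
  also have "\<dots> = fps_X ^ (w + x)" by (simp add: power_add mult.commute)
  finally show ?thesis by (simp add: fps_on_X_power)
qed

end

section \<open>Index of nilpotency and reduction number\<close>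

lemma zero_in_semigroup_span: "0 \<in> semigroup_span A"
  unfolding semigroup_span_def by (auto intro!: exI[of _ "\<lambda>_. 0"])

lemma semigroup_span_add:
  assumes "x \<in> semigroup_span A" "y \<in> semigroup_span A"
  shows "x + y \<in> semigroup_span A"
proof -
  obtain c d where "x = (\<Sum>a\<in>A. c a * a)" "y = (\<Sum>a\<in>A. d a * a)"
    using assms unfolding semigroup_span_def by blast
  then have "x + y = (\<Sum>a\<in>A. (c a + d a) * a)" by (simp add: sum.distrib distrib_right)
  then show ?thesis unfolding semigroup_span_def by (intro CollectI exI[of _ "\<lambda>a. c a + d a"]) simp
qed

lemma semigroup_span_base:
  assumes "finite A" "a \<in> A"
  shows "a \<in> semigroup_span A"
proof -
  have "(\<Sum>b\<in>A. (if b = a then 1 else 0) * b) = (\<Sum>b\<in>A. if b = a then b else 0)"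
    by (rule sum.cong) auto
  also have "\<dots> = a" using assms by simp
  finally show ?thesis
    unfolding semigroup_span_def by (intro CollectI exI[of _ "\<lambda>b. if b = a then 1 else 0"]) simp
qed

text \<open>A nonzero sum has a nonzero term \<open>c a * a\<close>; lower that coefficient by
  one.\<close>

lemma semigroup_span_step:
  assumes "finite A" "s \<in> semigroup_span A" "s \<noteq> 0"
  obtains a b where "a \<in> A" "b \<in> semigroup_span A" "s = a + b"
proof -
  obtain c where c: "s = (\<Sum>a\<in>A. c a * a)" using assms(2) by (auto simp: semigroup_span_def)
  have "\<exists>a\<in>A. c a * a \<noteq> 0"
  proof (rule ccontr)
    assume "\<not> ?thesis"
    then have "(\<Sum>a\<in>A. c a * a) = 0" by (intro sum.neutral) blast
    then show False using c assms(3) by simp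
  qed
  then obtain a where a: "a \<in> A" "c a * a \<noteq> 0" by blast
  from a(2) obtain k where k: "c a = Suc k" by (cases "c a") simp_all
  let ?b = "\<Sum>x\<in>A. (c(a := k)) x * x"
  have "s = c a * a + (\<Sum>x\<in>A - {a}. c x * x)"
    unfolding c by (rule sum.remove[OF assms(1) a(1)])
  moreover have "?b = k * a + (\<Sum>x\<in>A - {a}. c x * x)"
    by (subst sum.remove[OF assms(1) a(1)]) (auto intro!: sum.cong)
  moreover have "c a * a = a + k * a" using k by simp
  ultimately have "s = a + ?b" by linarith
  then show ?thesis using that[OF a(1)] unfolding semigroup_span_def by blast
qed

lemma generated_semigroup_of_gens:
  assumes "numerical_semigroup_gens S g n"
  shows "generated_semigroup S (g 1) (g ` {1..n})"
proof -
  let ?A = "g ` {1..n}"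
  have mono: "strict_mono_on {1..n} g" and Gcd: "Gcd ?A = 1" and S: "S = semigroup_span ?A"
    and min: "\<And>i. i \<in> {1..n} \<Longrightarrow> g i \<notin> semigroup_span (?A - {g i})"
    using assms by (auto simp: numerical_semigroup_gens_def)
  \<comment> \<open>For \<open>n = 0\<close> the gcd of the empty set would be 0.\<close>
  have n: "n \<ge> 1"
  proof (rule ccontr)
    assume "\<not> n \<ge> 1"
    then show False using Gcd by simp
  qed
  have pos: "g i \<noteq> 0" if "i \<in> {1..n}" for i
    using min[OF that] zero_in_semigroup_span by metis
  have le: "g 1 \<le> g i" if "i \<in> {1..n}" for i
    using strict_mono_on_leD[OF mono, of 1 i] that by auto
  have step: "\<exists>a\<in>?A. \<exists>b\<in>S. s = a + b" if "s \<in> S" "s \<noteq> 0" for s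
    unfolding S by (rule semigroup_span_step[of ?A s]) (use that S in auto)
  show ?thesis
  proof
    fix s assume "s \<in> S" "s \<noteq> 0"
    then obtain a b where "a \<in> ?A" "s = a + b" using step by blast
    then show "g 1 \<le> s" using le by fastforce
  next
    fix s assume "s \<in> S - {0}"
    then show "\<exists>a\<in>?A. \<exists>b\<in>S. s = a + b" using step by blast
  next
    show "g 1 \<in> S" unfolding S using n by (intro semigroup_span_base) auto
    have "0 \<notin> ?A" using pos by (metis imageE)
    then show "?A \<subseteq> S - {0}" unfolding S using semigroup_span_base[of ?A] by blast
    show "g 1 > 0" using pos[of 1] n by simp
  qed (auto simp: S zero_in_semigroup_span semigroup_span_add)
qed

theorem proposition5p9:
  fixes S :: "nat set" and g :: "nat \<Rightarrow> nat" and n :: nat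
    and R :: "'k::field fps ring" and m J :: "'k fps set"
  assumes "infinite (UNIV :: 'k set)"
    and "numerical_semigroup_gens S g n"
    and "M_pure S (g 1)"
    and "R = semigroup_ring S"
    and "m = semigroup_max_ideal S g n"
    and "J = PIdl\<^bsub>R\<^esub> (fps_X ^ g 1)"
    and "graded_Buchsbaum R m"
  shows "nilpotency_index R J m = reduction_number R m (fps_X ^ g 1)"
proof -
  interpret generated_semigroup S "g 1" "g ` {1..n}"
    using assms(2) by (rule generated_semigroup_of_gens)
  have m: "m = fps_on (multM S (Suc 0))"
    unfolding assms(5) semigroup_max_ideal_def genideal_gens[symmetric] by (simp add: image_image)
  have pow: "ideal_pow R m h = fps_on (multM S h)" for h
    unfolding assms(4) m by (rule ideal_pow_multM)
  have "J = (*) (fps_X ^ g 1) ` fps_on S"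
    unfolding assms(4,6) cgenideal_def by (auto simp: mult.commute)
  then have J: "J = fps_on ((+) (g 1) ` S)" by (simp add: fps_on_shift)
  have coset: "fps_X ^ g 1 <#\<^bsub>R\<^esub> ideal_pow R m h = fps_on ((+) (g 1) ` multM S h)" for h
    unfolding pow by (auto simp: fps_on_shift[symmetric] assms(4) l_coset_def)
  have "(LEAST k. multM S (Suc k) \<subseteq> (+) (g 1) ` S) = (LEAST r. multM S (Suc r) = (+) (g 1) ` multM S r)"
    by (rule nilpotency_eq_reduction[OF assms(3)])
      (rule Buchsbaum_no_torsion[OF assms(7)[unfolded assms(4) m]])
  then show ?thesis
    \<comment> \<open>Since \<open>fps_on\<close> reflects inclusion and equality, both minima over
      ideals turn into the minima over exponent sets just compared.\<close>
    unfolding nilpotency_index_def reduction_number_def coset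
    unfolding pow J fps_on_subset_iff fps_on_eq_iff by simp
qed

end
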